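(* Let $a_0<b_0$ be real numbers and let $S\subset[a_0,b_0]$ be the target set for the Cantor game on $[a_0,b_0]$. If $S$ is a Bernstein set in $[a_0,b_0]$, then player A does not have a winning strategy.
   Context: Base theory: ZFC. For $X\subset\mathbb{R}$ with the subspace topology, a Bernstein set in $X$ is a set $S\subset X$ such that neither $S$ nor $X-S$ contains an uncountable closed set (closed in $X$). Cantor game on $[a_0,b_0]$ with target set $S\subset[a_0,b_0]$: $a_0<b_0$ are fixed reals. At turn $n\ge1$ player A chooses a real $a_n$ with $a_{n-1}<a_n<b_{n-1}$, then player B chooses a real $b_n$ with $a_n<b_n<b_{n-1}$. Player A wins if $\lim_{n\to\infty}a_n\in S$; otherwise player B wins. A play is a pair of sequences $((a_n)_{n\ge0},(b_n)_{n\ge0})$, starting with the fixed $a_0,b_0$, with $a_{n-1}<a_n<b_n<b_{n-1}$ for all $n\ge1$. A strategy for player A is a sequence of real-valued functions $(f_n)_{n\ge0}$, where for $n\ge1$ the function $f_{n-1}$ is defined on all tuples $(a_0,b_0,a_1,b_1,\dots,a_{n-1},b_{n-1})$ (with $a_0,b_0$ the fixed values) satisfying $a_0<a_1<\dots<a_{n-1}<b_{n-1}<\dots<b_1<b_0$, and $a_{n-1}<f_{n-1}(a_0,b_0,\dots,a_{n-1},b_{n-1})<b_{n-1}$. A play is consistent with $(f_n)$ if $a_n=f_{n-1}(a_0,b_0,\dots,a_{n-1},b_{n-1})$ for all $n\ge1$. The limit set $L((f_n))$ is the set of all $\lim_{n\to\infty}a_n$ over plays consistent with $(f_n)$. The strategy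 $(f_n)$ is winning for player A if $L((f_n))\subset S$. *)

theory Defs
  imports "HOL-Analysis.Analysis"
begin

definition bernstein_in :: "real set \<Rightarrow> real set \<Rightarrow> bool" where
  "bernstein_in X S \<longleftrightarrow> S \<subseteq> X \<and>
     \<not> (\<exists>C. closedin (top_of_set X) C \<and> uncountable C \<and> C \<subseteq> S) \<and>
     \<not> (\<exists>C. closedin (top_of_set X) C \<and> uncountable C \<and> C \<subseteq> X - S)"

text \<open>The tuple $(a_0,b_0,\dots,a_{n-1},b_{n-1})$ is encoded as the list of pairs
  $[(a_0,b_0),\dots,(a_{n-1},b_{n-1})]$ of length $n$.\<close>

definition cantor_position :: "real \<Rightarrow> real \<Rightarrow> nat \<Rightarrow> (real \<times> real) list \<Rightarrow> bool" where
  "cantor_position a0 b0 n h \<longleftrightarrow> n \<ge> 1 \<and> length h = n \<and> h ! 0 = (a0, b0) \<and>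
     (\<forall>i. Suc i < n \<longrightarrow> fst (h ! i) < fst (h ! Suc i) \<and> snd (h ! Suc i) < snd (h ! i)) \<and>
     fst (h ! (n - 1)) < snd (h ! (n - 1))"

definition cantor_play :: "real \<Rightarrow> real \<Rightarrow> (nat \<Rightarrow> real) \<Rightarrow> (nat \<Rightarrow> real) \<Rightarrow> bool" where
  "cantor_play a0 b0 a b \<longleftrightarrow> a 0 = a0 \<and> b 0 = b0 \<and>
     (\<forall>n\<ge>1. a (n - 1) < a n \<and> a n < b n \<and> b n < b (n - 1))"

text \<open>The functions are total in HOL; only the values of \<open>f (n - 1)\<close> on positions of length
  \<open>n\<close> are constrained, and no other values are ever used.\<close>

definition strategy_A :: "real \<Rightarrow> real \<Rightarrow> (nat \<Rightarrow> (real \<times> real) list \<Rightarrow> real) \<Rightarrow> bool" where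
  "strategy_A a0 b0 f \<longleftrightarrow>
     (\<forall>n\<ge>1. \<forall>h. cantor_position a0 b0 n h \<longrightarrow>
        fst (h ! (n - 1)) < f (n - 1) h \<and> f (n - 1) h < snd (h ! (n - 1)))"

definition consistent_A ::
    "(nat \<Rightarrow> (real \<times> real) list \<Rightarrow> real) \<Rightarrow> (nat \<Rightarrow> real) \<Rightarrow> (nat \<Rightarrow> real) \<Rightarrow> bool" where
  "consistent_A f a b \<longleftrightarrow> (\<forall>n\<ge>1. a n = f (n - 1) (map (\<lambda>i. (a i, b i)) [0..<n]))"

definition strategy_limits ::
    "real \<Rightarrow> real \<Rightarrow> (nat \<Rightarrow> (real \<times> real) list \<Rightarrow> real) \<Rightarrow> real set" where
  "strategy_limits a0 b0 f =
     {x. \<exists>a b. cantor_play a0 b0 a b \<and> consistent_A f a b \<and> a \<longlonglongrightarrow> x}"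

definition winning_strategy_A ::
    "real \<Rightarrow> real \<Rightarrow> real set \<Rightarrow> (nat \<Rightarrow> (real \<times> real) list \<Rightarrow> real) \<Rightarrow> bool" where
  "winning_strategy_A a0 b0 S f \<longleftrightarrow> strategy_A a0 b0 f \<and> strategy_limits a0 b0 f \<subseteq> S"

end

(* Along a strategy of A, a position with reply a of A can be continued by two moves r > l of B with
   all later play after l strictly below all later play after r: pick r, let c > a be A's answer to
   r, and pick l between a and c.  If moreover B keeps b - a \<le> 2^-n at turn n, then mapping a sequence
   of binary choices to the limit of the resulting play is a continuous injection of the compact
   space of binary sequences into the limit set.  Its image is an uncountable closed subset of S. *)
theory Submission
  imports Defs
begin

section \<open>The space of binary sequences\<close>

lemma uncountable_UNIV_nat_bool: "uncountable (UNIV :: (nat \<Rightarrow> bool) set)"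
proof
  assume "countable (UNIV :: (nat \<Rightarrow> bool) set)"
  then obtain e :: "nat \<Rightarrow> nat \<Rightarrow> bool" where "surj e"
    using range_from_nat_into[of "UNIV :: (nat \<Rightarrow> bool) set"] by blast
  then obtain k where "(\<lambda>n. \<not> e n n) = e k"
    by (rule surjE)
  then have "(\<not> e k k) = e k k"
    by (rule fun_cong)
  then show False by simp
qed

text \<open>Tychonoff: the topology of the function type is the product topology, and each factor is
  finite.\<close>

lemma compact_UNIV_nat_bool: "compact (UNIV :: (nat \<Rightarrow> bool) set)"
proof -
  have "compact_space (euclidean :: bool topology)"
    by (simp add: compact_space_def finite_imp_compact)
  then have "compact_space (product_topology (\<lambda>_::nat. euclidean :: bool topology) UNIV)"
    by (simp add: compact_space_product_topology)
  then show ?thesis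
    by (simp add: euclidean_product_topology compact_space_def)
qed

text \<open>A finite intersection of preimages of points under coordinate maps; these sets serve as
  the neighbourhoods of \<open>x\<close> in \<open>continuous_limit\<close>.\<close>

lemma open_agree_below: "open {y :: nat \<Rightarrow> bool. \<forall>i<n. y i = x i}"
proof -
  have "open ((\<lambda>y :: nat \<Rightarrow> bool. y i) -` {x i})" for i
    by (rule open_vimage) (auto intro: open_discrete continuous_on_product_coordinates)
  then have "open (\<Inter>i<n. (\<lambda>y :: nat \<Rightarrow> bool. y i) -` {x i})"
    by (intro open_INT) auto
  then show ?thesis
    by (rule back_subst[where P = "open"]) auto
qed

section \<open>Positions and the two moves of B\<close>

lemma cantor_position_snoc:
  assumes "cantor_position a0 b0 n h" "fst (h ! (n - 1)) < a" "a < b" "b < snd (h ! (n - 1))"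
  shows "cantor_position a0 b0 (Suc n) (h @ [(a, b)])"
proof -
  \<comment> \<open>The only new pair of neighbours joins the last entry of \<open>h\<close> to the
    appended one; this rewrites its index to the form used in the assumptions.\<close>
  have "Suc i = length h \<Longrightarrow> i = length h - 1" for i
    by simp
  then show ?thesis
    using assms unfolding cantor_position_def
    by (auto simp: nth_append less_Suc_eq simp del: One_nat_def)
qed

locale strategy_game =
  fixes a0 b0 :: real and f :: "nat \<Rightarrow> (real \<times> real) list \<Rightarrow> real"
  assumes a0_less_b0: "a0 < b0" and strategy: "strategy_A a0 b0 f"
begin

definition reply_A :: "(real \<times> real) list \<Rightarrow> real" where
  "reply_A h = f (length h - 1) h"

text \<open>This is r. The midpoint keeps it legal, and the second term makes the intervals shrink
  to points. Both terms exceed A's reply.\<close>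

definition upper_B :: "(real \<times> real) list \<Rightarrow> real" where
  "upper_B h = min ((reply_A h + snd (last h)) / 2) (reply_A h + (1/2) ^ length h)"

text \<open>\<open>True\<close> selects r; \<open>False\<close> selects l, taken as the midpoint of
  a and c.\<close>

definition move_B :: "(real \<times> real) list \<Rightarrow> bool \<Rightarrow> real" where
  "move_B h c = (if c then upper_B h else (reply_A h + reply_A (h @ [(reply_A h, upper_B h)])) / 2)"

primrec branch :: "(nat \<Rightarrow> bool) \<Rightarrow> nat \<Rightarrow> (real \<times> real) list" where
  "branch x 0 = [(a0, b0)]"
| "branch x (Suc n) = branch x n @ [(reply_A (branch x n), move_B (branch x n) (x n))]"

abbreviation left :: "(nat \<Rightarrow> bool) \<Rightarrow> nat \<Rightarrow> real" where
  "left x n \<equiv> fst (last (branch x n))"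

abbreviation right :: "(nat \<Rightarrow> bool) \<Rightarrow> nat \<Rightarrow> real" where
  "right x n \<equiv> snd (last (branch x n))"

lemma length_branch [simp]: "length (branch x n) = Suc n"
  by (induction n) auto

text \<open>Gives the history the shape in which \<open>consistent_A\<close> feeds it to the
  strategy.\<close>

lemma branch_eq_map: "branch x n = map (\<lambda>i. (left x i, right x i)) [0..<Suc n]"
proof (induction n)
  case (Suc n)
  have "branch x (Suc n) = branch x n @ [(left x (Suc n), right x (Suc n))]"
    by simp
  also have "\<dots> = map (\<lambda>i. (left x i, right x i)) [0..<Suc n] @ [(left x (Suc n), right x (Suc n))]"
    using Suc.IH by (rule arg_cong)
  finally show ?case
    by (simp del: branch.simps)
qed simp

lemma branch_cong: "(\<And>i. i < n \<Longrightarrow> x i = y i) \<Longrightarrow> branch x n = branch y n"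
  by (induction n) auto

lemma reply_A_bounds:
  assumes "cantor_position a0 b0 (length h) h"
  shows "fst (last h) < reply_A h" "reply_A h < snd (last h)"
proof -
  have "length h \<ge> 1" using assms by (simp add: cantor_position_def)
  moreover from this have "last h = h ! (length h - 1)" by (intro last_conv_nth) auto
  ultimately show "fst (last h) < reply_A h" "reply_A h < snd (last h)"
    using strategy assms by (auto simp: strategy_A_def reply_A_def)
qed

lemma position_snoc:
  assumes "cantor_position a0 b0 (length h) h" "reply_A h < b" "b < snd (last h)"
  shows "cantor_position a0 b0 (length (h @ [(reply_A h, b)])) (h @ [(reply_A h, b)])"
proof -
  have "length h \<ge> 1" using assms by (simp add: cantor_position_def)
  then have "last h = h ! (length h - 1)" by (intro last_conv_nth) auto
  then show ?thesis
    using cantor_position_snoc[OF assms(1), of "reply_A h" b] reply_A_bounds[OF assms(1)] assms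
    by simp
qed

lemma upper_B_bounds:
  assumes "cantor_position a0 b0 (length h) h"
  shows "reply_A h < upper_B h" "upper_B h < snd (last h)"
    "upper_B h \<le> reply_A h + (1/2) ^ length h"
  using reply_A_bounds[OF assms] by (auto simp: upper_B_def min_def)

lemma reply_upper_B:
  assumes "cantor_position a0 b0 (length h) h"
  shows "reply_A h < reply_A (h @ [(reply_A h, upper_B h)])"
    "reply_A (h @ [(reply_A h, upper_B h)]) < upper_B h"
  using reply_A_bounds[OF position_snoc[OF assms upper_B_bounds(1,2)[OF assms]]] by auto

text \<open>The lower move lies between a and c, and c is below \<open>upper_B h\<close>, so it
  inherits the upper bounds of \<open>upper_B h\<close>.\<close>

lemma move_B_bounds:
  assumes "cantor_position a0 b0 (length h) h"
  shows "reply_A h < move_B h c" "move_B h c < snd (last h)"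
    "move_B h c \<le> reply_A h + (1/2) ^ length h"
  using upper_B_bounds[OF assms] reply_upper_B[OF assms] by (auto simp: move_B_def)

lemma position_branch: "cantor_position a0 b0 (Suc n) (branch x n)"
proof (induction n)
  case 0
  then show ?case using a0_less_b0 by (simp add: cantor_position_def)
next
  case (Suc n)
  then show ?case
    using position_snoc[of "branch x n"] move_B_bounds[of "branch x n"] by simp
qed

lemma position_branch': "cantor_position a0 b0 (length (branch x n)) (branch x n)"
  by (simp add: position_branch)

lemma left_Suc: "left x n < left x (Suc n)"
  using reply_A_bounds[OF position_branch'] by simp

lemma left_less_right: "left x n < right x n"
proof (cases n)
  case 0
  then show ?thesis using a0_less_b0 by simp
next
  case (Suc m)
  then show ?thesis using move_B_bounds[OF position_branch'] by simp
qed

lemma right_Suc: "right x (Suc n) < right x n"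
  using move_B_bounds[OF position_branch'] by simp

lemma right_minus_left: "right x (Suc n) - left x (Suc n) \<le> (1/2) ^ Suc n"
  using move_B_bounds(3)[OF position_branch', of x n "x n"] by simp

section \<open>Limits of branches\<close>

definition limit :: "(nat \<Rightarrow> bool) \<Rightarrow> real" where
  "limit x = (SUP n. left x n)"

text \<open>By monotonicity both ends can be compared at the common stage
  \<open>max m n\<close>.\<close>

lemma left_less_right': "left x m < right x n"
proof -
  have "left x m \<le> left x (max m n)"
    by (rule lift_Suc_mono_le[of "left x"]) (rule less_imp_le[OF left_Suc], simp)
  also have "\<dots> < right x (max m n)" by (rule left_less_right)
  also have "\<dots> \<le> right x n"
    by (rule lift_Suc_antimono_le[of "right x"]) (rule less_imp_le[OF right_Suc], simp)
  finally show ?thesis .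
qed

lemma bdd_above_left: "bdd_above (range (left x))"
  using left_less_right'[of x _ 0] by (intro bdd_aboveI[of _ "right x 0"]) (auto simp: less_imp_le)

lemma left_le_limit: "left x n \<le> limit x"
  unfolding limit_def by (rule cSUP_upper[OF _ bdd_above_left]) simp

lemma limit_le_right: "limit x \<le> right x n"
  unfolding limit_def by (rule cSUP_least) (auto intro: less_imp_le left_less_right')

lemma left_tendsto: "left x \<longlonglongrightarrow> limit x"
  unfolding limit_def
  by (rule LIMSEQ_incseq_SUP[OF bdd_above_left]) (intro incseq_SucI less_imp_le left_Suc)

lemma limit_in_strategy_limits: "limit x \<in> strategy_limits a0 b0 f"
proof -
  have "cantor_play a0 b0 (left x) (right x)"
    unfolding cantor_play_def
  proof (intro conjI allI impI)
    fix n :: nat assume "n \<ge> 1"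
    then obtain m where "n = Suc m" by (cases n) auto
    then show "left x (n - 1) < left x n" "left x n < right x n" "right x n < right x (n - 1)"
      using left_Suc[of x m] left_less_right[of x n] right_Suc[of x m] by auto
  qed auto
  moreover have "consistent_A f (left x) (right x)"
    unfolding consistent_A_def
  proof (intro allI impI)
    fix n :: nat assume "n \<ge> 1"
    then obtain m where n: "n = Suc m" by (cases n) auto
    have "left x n = f m (branch x m)"
      by (simp add: n reply_A_def)
    also have "branch x m = map (\<lambda>i. (left x i, right x i)) [0..<n]"
      using branch_eq_map n by blast
    finally show "left x n = f (n - 1) (map (\<lambda>i. (left x i, right x i)) [0..<n])"
      by (simp add: n)
  qed
  ultimately show ?thesis
    using left_tendsto unfolding strategy_limits_def by blast
qed

text \<open>Both plays share the position \<open>h\<close> at the first differing bit; A's answer c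
  to the upper move then separates the limits.\<close>

lemma limit_less:
  assumes "\<And>i. i < n \<Longrightarrow> x i = y i" "\<not> x n" "y n"
  shows "limit x < limit y"
proof -
  define h where "h = branch x n"
  have h': "branch y n = h" unfolding h_def by (rule branch_cong[symmetric]) (rule assms)
  have h: "cantor_position a0 b0 (length h) h"
    unfolding h_def by (rule position_branch')
  have "limit x \<le> right x (Suc n)" by (rule limit_le_right)
  also have "right x (Suc n) < reply_A (h @ [(reply_A h, upper_B h)])"
    using reply_upper_B[OF h] assms(2) by (simp add: h_def[symmetric] move_B_def)
  \<comment> \<open>Bit \<open>n\<close> fixes B's move at turn \<open>Suc n\<close>, so A's answer
    to it appears one turn later.\<close>
  also have "\<dots> = left y (Suc (Suc n))"
    using assms(3) by (simp add: h' move_B_def)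
  also have "\<dots> \<le> limit y" by (rule left_le_limit)
  finally show ?thesis .
qed

text \<open>Distinct sequences have a least differing index, where \<open>limit_less\<close> applies
  in one order or the other.\<close>

lemma inj_limit: "inj limit"
proof (rule injI, rule ccontr)
  fix x y assume eq: "limit x = limit y" and "x \<noteq> y"
  then obtain k where "x k \<noteq> y k" by blast
  define n where "n = (LEAST n. x n \<noteq> y n)"
  have "x n \<noteq> y n" unfolding n_def by (rule LeastI) fact
  moreover have "x i = y i" if "i < n" for i
    using not_less_Least that unfolding n_def by blast
  ultimately show False
    using limit_less[of n x y] limit_less[of n y x] eq by (cases "x n") auto
qed

text \<open>Both limits lie in the last interval of the common branch, whose length is bounded by
  \<open>right_minus_left\<close>.\<close>

lemma dist_limit_le:
  assumes "\<And>i. i < Suc n \<Longrightarrow> x i = y i"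
  shows "dist (limit x) (limit y) \<le> (1/2) ^ Suc n"
proof -
  have eq: "branch x (Suc n) = branch y (Suc n)" by (rule branch_cong) (rule assms)
  show ?thesis
    using left_le_limit[of x "Suc n"] limit_le_right[of x "Suc n"] left_le_limit[of y "Suc n"]
      limit_le_right[of y "Suc n"] right_minus_left[of y n]
    unfolding eq dist_real_def by linarith
qed

lemma continuous_limit: "continuous_on UNIV limit"
  unfolding continuous_on_def
proof (intro ballI tendstoI)
  fix x :: "nat \<Rightarrow> bool" and e :: real assume "e > 0"
  then obtain n where n: "(1/2 :: real) ^ n < e"
    using real_arch_pow_inv[of e "1/2"] by auto
  \<comment> \<open>The length bound starts only at turn 1, since the initial interval is arbitrary;
    hence the shift to \<open>Suc n\<close>.\<close>
  have "(1/2 :: real) ^ Suc n \<le> (1/2) ^ n" by simp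
  with n have "(1/2 :: real) ^ Suc n < e" by linarith
  then have "dist (limit y) (limit x) < e" if "\<forall>i<Suc n. y i = x i" for y
    using dist_limit_le[of n y x] that by (meson le_less_trans)
  then show "\<forall>\<^sub>F y in at x. dist (limit y) (limit x) < e"
    unfolding eventually_at_topological
    by (intro exI[of _ "{y. \<forall>i<Suc n. y i = x i}"]) (use open_agree_below in auto)
qed

lemma compact_range_limit: "compact (range limit)"
  using continuous_limit compact_UNIV_nat_bool by (rule compact_continuous_image)

lemma uncountable_range_limit: "uncountable (range limit)"
  using inj_limit uncountable_UNIV_nat_bool by (simp add: countable_image_inj_eq)

end

theorem corollary5:
  fixes a0 b0 :: real and S :: "real set"
  assumes "a0 < b0"
    and "S \<subseteq> {a0..b0}"
    and "bernstein_in {a0..b0} S"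
  shows "\<not> (\<exists>f. winning_strategy_A a0 b0 S f)"
proof
  assume "\<exists>f. winning_strategy_A a0 b0 S f"
  then obtain f where f: "strategy_A a0 b0 f" "strategy_limits a0 b0 f \<subseteq> S"
    unfolding winning_strategy_A_def by blast
  interpret strategy_game a0 b0 f
    using assms(1) f(1) by unfold_locales
  have "range limit \<subseteq> S"
    using limit_in_strategy_limits f(2) by blast
  \<comment> \<open>Compactness makes the range closed in the reals, and it lies in the interval
    because \<open>S\<close> does.\<close>
  moreover from this have "closedin (top_of_set {a0..b0}) (range limit)"
    using assms(2) compact_imp_closed[OF compact_range_limit] by (intro closed_subset) auto
  ultimately show False
    using assms(3) uncountable_range_limit unfolding bernstein_in_def by blast
qed

end
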